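(* Let $P$ be a finite set of points in $\mathbb{R}^2$ in general position and let $k$ be a positive integer. If $\dim(P) = k$, then $|P| \leq 2^{k-1}$.
   Context: General position means no three points on a line. For a finite point set $P\subseteq\mathbb{R}^2$ put $\mathscr{L}(A)=\operatorname{conv}(A)\cap P$ for $A\subseteq P$. A subset $A\subseteq P$ is closed if $\mathscr{L}(A)=A$; the closed sets ordered by inclusion form the lattice of closed sets $\mathcal{L}$. $\dim(P)$ denotes the order dimension of $\mathcal{L}$, where the order dimension of a poset is the least positive integer $t$ such that the partial order is the intersection of $t$ of its linear extensions. *)

theory Defs
  imports "HOL-Analysis.Analysis"
begin

definition linear_extension_on :: "'a set \<Rightarrow> 'a rel \<Rightarrow> 'a rel \<Rightarrow> bool" where
  "linear_extension_on X r l \<longleftrightarrow> linear_order_on X l \<and> r \<subseteq> l"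

(* Meaningful only if some nonempty finite set of linear extensions of r has
   intersection r, as is the case for every partial order on a finite set X.
   As t is least, it does not matter whether the t linear extensions are
   required to be distinct. One-element posets and chains have dimension 1. *)
definition order_dimension_on :: "'a set \<Rightarrow> 'a rel \<Rightarrow> nat" where
  "order_dimension_on X r =
     (LEAST t. 0 < t \<and> (\<exists>E. card E = t \<and> (\<forall>l\<in>E. linear_extension_on X r l) \<and> \<Inter>E = r))"

definition general_position :: "(real^2) set \<Rightarrow> bool" where
  "general_position P \<longleftrightarrow>
     (\<forall>a\<in>P. \<forall>b\<in>P. \<forall>c\<in>P. a \<noteq> b \<and> b \<noteq> c \<and> a \<noteq> c \<longrightarrow> \<not> collinear {a, b, c})"

definition conv_closure :: "(real^2) set \<Rightarrow> (real^2) set \<Rightarrow> (real^2) set" where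
  "conv_closure P A = convex hull A \<inter> P"

definition closed_subsets :: "(real^2) set \<Rightarrow> (real^2) set set" where
  "closed_subsets P = {A. A \<subseteq> P \<and> conv_closure P A = A}"

definition inclusion_on :: "'a set set \<Rightarrow> 'a set rel" where
  "inclusion_on F = {(A, B). A \<in> F \<and> B \<in> F \<and> A \<subseteq> B}"

definition conv_dim :: "(real^2) set \<Rightarrow> nat" where
  "conv_dim P = order_dimension_on (closed_subsets P) (inclusion_on (closed_subsets P))"

end

theory Submission
  imports Defs "HOL-Library.Nat_Bijection"
begin

text \<open>
  A realizer \<open>E\<close> of the lattice orders the points, viewed as singletons. Say that \<open>x\<close> beats \<open>y\<close> in
  \<open>l \<in> E\<close> if \<open>y\<close> precedes \<open>x\<close> there. If \<open>x\<close> is not in the convex hull of \<open>A\<close>, then \<open>x\<close> beats all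
  of \<open>A\<close> in some \<open>l \<in> E\<close>. Fix \<open>x\<close> and join \<open>l, m \<in> E\<close> by an edge if every other point is beaten by
  \<open>x\<close> in \<open>l\<close> or in \<open>m\<close>. For each \<open>l\<close> let \<open>U\<^sub>l\<close> be the open set of directions \<open>u\<close> such that \<open>x\<close> beats in
  \<open>l\<close> all points not ahead of \<open>x\<close> in direction \<open>u\<close>. These sets cover the unit circle, and
  \<open>l\<close> and \<open>m\<close> are joined as soon as \<open>u \<in> U\<^sub>l\<close> and \<open>- u \<in> U\<^sub>m\<close>. By connectedness of the circle the graph is
  not 2-colourable, so it contains an odd cycle. Any other point is beaten by \<open>x\<close> in more
  than half of the vertices of this cycle. Hence distinct points have odd cycles with distinct vertex
  sets, and there are only \<open>2 ^ (card E - 1)\<close> subsets of \<open>E\<close> of odd size.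
\<close>

section \<open>Odd cycles\<close>

lemma sym_relpow: "sym G \<Longrightarrow> (a, b) \<in> G ^^ n \<Longrightarrow> (b, a) \<in> G ^^ n"
proof (induction n arbitrary: b)
  case (Suc n)
  then obtain c where "(a, c) \<in> G ^^ n" "(c, b) \<in> G" by auto
  with Suc have "(c, a) \<in> G ^^ n" "(b, c) \<in> G" by (auto dest: symD)
  then show ?case by (rule relpow_Suc_I2[rotated])
qed simp

text \<open>Colour each vertex by whether an even walk reaches it from a representative of its
  component. An edge whose ends have equal colour closes two walks of equal parity into an odd
  closed walk.\<close>

lemma not_bipartite_imp_odd_closed_walk:
  assumes "sym G"
    and not_bip: "\<And>R. \<exists>(a, b)\<in>G. a \<in> R \<longleftrightarrow> b \<in> R"
  obtains a n where "odd n" "(a, a) \<in> G ^^ n"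
proof -
  \<comment> \<open>The choice depends only on the set of vertices reachable from \<open>a\<close>,
    so all of a component shares one representative.\<close>
  define rep where "rep a = (SOME r. (a, r) \<in> G\<^sup>*)" for a
  define R where "R = {a. \<exists>n. even n \<and> (rep a, a) \<in> G ^^ n}"
  obtain a b where ab: "(a, b) \<in> G" and same: "a \<in> R \<longleftrightarrow> b \<in> R"
    using not_bip[of R] by auto
  have ba: "(b, a) \<in> G" using ab \<open>sym G\<close> by (auto dest: symD)
  have "(a, r) \<in> G\<^sup>* \<longleftrightarrow> (b, r) \<in> G\<^sup>*" for r
    using ab ba by (meson converse_rtrancl_into_rtrancl)
  then have rep: "rep b = rep a" by (simp add: rep_def)
  have walk: "\<exists>n. (rep c, c) \<in> G ^^ n" for c
  proof -
    have "(c, rep c) \<in> G\<^sup>*" unfolding rep_def by (rule someI[of _ c]) simp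
    then show ?thesis using sym_relpow[OF \<open>sym G\<close>] by (auto dest!: rtrancl_imp_relpow)
  qed
  obtain m n where m: "(rep a, a) \<in> G ^^ m" and n: "(rep a, b) \<in> G ^^ n"
    and par: "even m \<longleftrightarrow> even n"
  proof (cases "a \<in> R")
    case True
    with same rep that show ?thesis by (auto simp: R_def)
  next
    case False
    \<comment> \<open>Outside \<open>R\<close> every walk from the representative is odd, and some
      walk exists.\<close>
    with same rep walk[of a] walk[of b] that show ?thesis by (auto simp: R_def)
  qed
  have "(rep a, b) \<in> G ^^ Suc m" using m ab by auto
  then have "(rep a, rep a) \<in> G ^^ (Suc m + n)"
    using sym_relpow[OF \<open>sym G\<close> n] unfolding relpow_add by (rule relcompI)
  then show ?thesis using that[of "Suc m + n" "rep a"] par by auto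
qed

text \<open>A shortest odd closed walk repeats no vertex: a repetition would cut it into two shorter
  closed walks, one of them odd. A loop counts as a cycle with \<open>m = 1\<close>.\<close>

lemma odd_closed_walk_imp_odd_cycle:
  assumes "odd n" "(a, a) \<in> G ^^ n"
  obtains f m where "odd m" "f m = f 0" "inj_on f {..<m}" "\<And>i. i < m \<Longrightarrow> (f i, f (Suc i)) \<in> G"
proof -
  define Q where "Q n \<longleftrightarrow> odd n \<and> (\<exists>a. (a, a) \<in> G ^^ n)" for n
  define m where "m = (LEAST n. Q n)"
  have "Q n" using assms by (auto simp: Q_def)
  then have "Q m" unfolding m_def by (rule LeastI)
  have least: "m \<le> j" if "Q j" for j unfolding m_def using that by (rule Least_le)
  obtain a where "odd m" "(a, a) \<in> G ^^ m" using \<open>Q m\<close> by (auto simp: Q_def)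
  then obtain f where f: "f 0 = a" "f m = a" "\<And>i. i < m \<Longrightarrow> (f i, f (Suc i)) \<in> G"
    by (auto simp: relpow_fun_conv)
  have seg: "(f i, f (i + d)) \<in> G ^^ d" if "i + d \<le> m" for i d
    unfolding relpow_fun_conv using that f(3) by (intro exI[of _ "\<lambda>t. f (i + t)"]) auto
  have neq: "f i \<noteq> f j" if "i < j" "j < m" for i j
  proof
    assume eq: "f i = f j"
    have inner: "(f i, f i) \<in> G ^^ (j - i)" using seg[of i "j - i"] that eq by simp
    have "(f 0, f i) \<in> G ^^ i" using seg[of 0 i] that by simp
    moreover have "(f i, f 0) \<in> G ^^ (m - j)" using seg[of j "m - j"] that eq f by simp
    ultimately have outer: "(f 0, f 0) \<in> G ^^ (i + (m - j))"
      unfolding relpow_add by (rule relcompI)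
    have "m = (j - i) + (i + (m - j))" using that by simp
    then have "odd (j - i) \<or> odd (i + (m - j))" using \<open>odd m\<close> by (metis even_add)
    then have "Q (j - i) \<or> Q (i + (m - j))" using inner outer by (auto simp: Q_def)
    then have "m \<le> j - i \<or> m \<le> i + (m - j)" using least by blast
    then show False using that by linarith
  qed
  have "inj_on f {..<m}"
    by (rule linorder_inj_onI) (use neq in auto)
  then show ?thesis using that \<open>odd m\<close> f by metis
qed

text \<open>The cyclic successor \<open>s\<close> maps the indices of \<open>Y\<close> injectively
  to indices outside \<open>Y\<close>, so they make up at most half of the cycle; oddness makes this
  strict.\<close>

lemma card_independent_in_odd_cycle:
  assumes "odd m" "f m = f 0" "inj_on f {..<m}" "\<And>i. i < m \<Longrightarrow> (f i, f (Suc i)) \<in> G"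
    and Y: "Y \<subseteq> f ` {..<m}" and indep: "\<And>a b. a \<in> Y \<Longrightarrow> b \<in> Y \<Longrightarrow> (a, b) \<notin> G"
  shows "2 * card Y < m"
proof -
  define J where "J = {i. i < m \<and> f i \<in> Y}"
  define s where "s i = (if Suc i = m then 0 else Suc i)" for i
  have J: "J \<subseteq> {..<m}" by (auto simp: J_def)
  then have "finite J" by (rule finite_subset) simp
  have "Y = f ` J" using Y by (auto simp: J_def)
  then have "card Y \<le> card J" using \<open>finite J\<close> by (simp add: card_image_le)
  have fs: "f (s i) = f (Suc i)" for i using \<open>f m = f 0\<close> by (auto simp: s_def)
  have "inj_on s J" using J by (auto simp: inj_on_def s_def split: if_splits)
  then have "card (s ` J) = card J" by (rule card_image)
  moreover have "J \<inter> s ` J = {}"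
  proof -
    have "s i \<notin> J" if "i \<in> J" for i
      using that indep[of "f i" "f (s i)"] assms(4)[of i] fs[of i] by (auto simp: J_def)
    then show ?thesis by blast
  qed
  moreover have "J \<union> s ` J \<subseteq> {..<m}" using J by (auto simp: s_def)
  then have "card (J \<union> s ` J) \<le> m" using card_mono[of "{..<m}"] by simp
  ultimately have "2 * card J \<le> m" using \<open>finite J\<close> by (simp add: card_Un_disjoint)
  then have "2 * card J \<noteq> m \<Longrightarrow> 2 * card J < m" by simp
  moreover have "2 * card J \<noteq> m" using \<open>odd m\<close> by auto
  ultimately show ?thesis using \<open>card Y \<le> card J\<close> by linarith
qed

lemma card_odd_subsets_le:
  assumes "finite E" "E \<noteq> {}"
  shows "card {O'. O' \<subseteq> E \<and> odd (card O')} \<le> 2 ^ (card E - 1)"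
proof -
  obtain e where e: "e \<in> E" using assms by blast
  let ?S = "{O'. O' \<subseteq> E \<and> odd (card O')}"
  \<comment> \<open>The parity of what remains tells whether \<open>e\<close> was removed.\<close>
  have "inj_on (\<lambda>O'. O' - {e}) ?S"
  proof (rule inj_onI)
    fix A B assume A: "A \<in> ?S" and B: "B \<in> ?S" and eq: "A - {e} = B - {e}"
    have "odd (card (S - {e})) \<longleftrightarrow> e \<notin> S" if "S \<in> ?S" for S
    proof (cases "e \<in> S")
      case True
      have "finite S" using that assms by (auto intro: finite_subset)
      then have "card S = Suc (card (S - {e}))" using True by (rule card.remove)
      then have "even (card (S - {e}))" using that by (metis (no_types, lifting) even_Suc mem_Collect_eq)
      with True show ?thesis by blast
    next
      case False
      with that show ?thesis by simp
    qed
    from this[OF A] this[OF B]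
    have "e \<in> A \<longleftrightarrow> e \<in> B" unfolding eq by blast
    then show "A = B" using eq by blast
  qed
  moreover have "(\<lambda>O'. O' - {e}) ` ?S \<subseteq> Pow (E - {e})" by auto
  ultimately have "card ?S \<le> card (Pow (E - {e}))"
    using assms by (intro card_inj_on_le) auto
  then show ?thesis using assms e by (simp add: card_Pow)
qed

text \<open>The combinatorial core, free of geometry: each point gets the vertex set of an odd cycle
  in its own graph on \<open>E\<close>, and distinct points get distinct sets.\<close>

lemma card_le_if_not_bipartite:
  fixes beats :: "'l \<Rightarrow> 'p \<Rightarrow> 'p \<Rightarrow> bool"
  assumes "finite E" "E \<noteq> {}"
    and asym: "\<And>l x y. l \<in> E \<Longrightarrow> x \<in> P \<Longrightarrow> y \<in> P \<Longrightarrow> x \<noteq> y \<Longrightarrow> beats l x y \<Longrightarrow> \<not> beats l y x"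
    and not_bip: "\<And>x R. x \<in> P \<Longrightarrow> \<exists>l\<in>E. \<exists>m\<in>E. (l \<in> R \<longleftrightarrow> m \<in> R) \<and>
                    (\<forall>y\<in>P - {x}. beats l x y \<or> beats m x y)"
  shows "card P \<le> 2 ^ (card E - 1)"
proof -
  have "\<exists>O'. O' \<subseteq> E \<and> odd (card O') \<and>
             (\<forall>y\<in>P - {x}. 2 * card {l\<in>O'. \<not> beats l x y} < card O')" if "x \<in> P" for x
  proof -
    define G where "G = {(l, m) \<in> E \<times> E. \<forall>y\<in>P - {x}. beats l x y \<or> beats m x y}"
    have "sym G" by (auto simp: G_def sym_def)
    moreover have "\<exists>(a, b)\<in>G. a \<in> R \<longleftrightarrow> b \<in> R" for R
      using not_bip[OF that, of R] unfolding G_def by blast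
    ultimately obtain a n where "odd n" "(a, a) \<in> G ^^ n"
      using not_bipartite_imp_odd_closed_walk by metis
    then obtain f m where f: "odd m" "f m = f 0" "inj_on f {..<m}"
        "\<And>i. i < m \<Longrightarrow> (f i, f (Suc i)) \<in> G"
      using odd_closed_walk_imp_odd_cycle by metis
    let ?O = "f ` {..<m}"
    have "?O \<subseteq> E" using f(4) by (auto simp: G_def)
    moreover have card: "card ?O = m" using f(3) by (simp add: card_image)
    \<comment> \<open>The vertices where \<open>x\<close> fails to beat \<open>y\<close> are
      independent, since an edge requires success at one of its ends.\<close>
    moreover have "2 * card {l\<in>?O. \<not> beats l x y} < m" if "y \<in> P - {x}" for y
      using f by (rule card_independent_in_odd_cycle) (use that in \<open>auto simp: G_def\<close>)
    ultimately show ?thesis using f(1) by metis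
  qed
  then obtain C where C: "\<And>x. x \<in> P \<Longrightarrow> C x \<subseteq> E \<and> odd (card (C x))"
    and maj: "\<And>x y. x \<in> P \<Longrightarrow> y \<in> P - {x} \<Longrightarrow> 2 * card {l\<in>C x. \<not> beats l x y} < card (C x)"
    by metis
  have "inj_on C P"
  proof (rule inj_onI, rule ccontr)
    fix x y assume xy: "x \<in> P" "y \<in> P" "C x = C y" "x \<noteq> y"
    have fin: "finite (C x)" using C[OF xy(1)] \<open>finite E\<close> by (auto intro: finite_subset)
    \<comment> \<open>By \<open>asym\<close>, one of the two points fails at each vertex, yet each
      fails at fewer than half.\<close>
    have "C x \<subseteq> {l\<in>C x. \<not> beats l x y} \<union> {l\<in>C x. \<not> beats l y x}"
      using asym xy C by blast
    then have "card (C x) \<le> card ({l\<in>C x. \<not> beats l x y} \<union> {l\<in>C x. \<not> beats l y x})"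
      using fin by (intro card_mono) auto
    also have "\<dots> \<le> card {l\<in>C x. \<not> beats l x y} + card {l\<in>C x. \<not> beats l y x}"
      by (rule card_Un_le)
    finally show False using maj[of x y] maj[of y x] xy by auto
  qed
  moreover have "C ` P \<subseteq> {O'. O' \<subseteq> E \<and> odd (card O')}" using C by auto
  ultimately have "card P \<le> card {O'. O' \<subseteq> E \<and> odd (card O')}"
    using \<open>finite E\<close> by (intro card_inj_on_le) auto
  also have "\<dots> \<le> 2 ^ (card E - 1)" using assms(1,2) by (rule card_odd_subsets_le)
  finally show ?thesis .
qed

section \<open>Directions at a point of a planar set\<close>

text \<open>In the plane the vectors orthogonal to \<open>u\<close> are the multiples of its quarter
  turn \<open>v\<close>.\<close>

lemma collinear_if_orthogonal:
  fixes u x y z :: "real^2"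
  assumes "u \<noteq> 0" "u \<bullet> (y - x) = 0" "u \<bullet> (z - x) = 0"
  shows "collinear {x, y, z}"
proof -
  define v :: "real^2" where "v = vector [- u $ 2, u $ 1]"
  have uu: "u $ 1 * u $ 1 + u $ 2 * u $ 2 \<noteq> 0"
    using \<open>u \<noteq> 0\<close> by (auto simp: vec_eq_iff forall_2 sum_squares_eq_zero_iff)
  have orth: "\<exists>c. w = c *\<^sub>R v" if "u \<bullet> w = 0" for w
  proof
    have "u $ 1 * w $ 1 + u $ 2 * w $ 2 = 0" using that by (simp add: inner_vec_def sum_2)
    then show "w = ((v \<bullet> w) / (u \<bullet> u)) *\<^sub>R v"
      using uu unfolding v_def
      by (simp add: vec_eq_iff forall_2 inner_vec_def sum_2 field_simps) algebra
  qed
  have "u \<bullet> (p - q) = 0" if "p \<in> {x, y, z}" "q \<in> {x, y, z}" for p q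
    using that assms by (auto simp: inner_diff_right)
  then show ?thesis unfolding collinear_def using orth by metis
qed

text \<open>By general position the boundary line through \<open>x\<close> carries at most one other
  point \<open>b\<close> of \<open>P\<close>. An open half-plane together with one boundary point is
  convex, and here it misses \<open>x\<close>.\<close>

lemma not_in_convex_hull_of_closed_halfplane:
  assumes "general_position P" "x \<in> P" "u \<noteq> 0"
  shows "x \<notin> convex hull {y\<in>P - {x}. u \<bullet> (y - x) \<le> 0}"
proof -
  let ?S = "{y\<in>P - {x}. u \<bullet> (y - x) \<le> 0}"
  have uniq: "y = z" if "y \<in> P - {x}" "z \<in> P - {x}" "u \<bullet> (y - x) = 0" "u \<bullet> (z - x) = 0" for y z
  proof (rule ccontr)
    assume "y \<noteq> z"
    moreover have "collinear {x, y, z}" using \<open>u \<noteq> 0\<close> that(3,4) by (rule collinear_if_orthogonal)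
    moreover have "y \<in> P" "z \<in> P" "x \<noteq> y" "x \<noteq> z" using that by auto
    ultimately show False using assms(1,2) unfolding general_position_def by metis
  qed
  obtain b where b: "b \<noteq> x" "u \<bullet> (b - x) \<le> 0" "\<And>y. y \<in> ?S \<Longrightarrow> u \<bullet> (y - x) < 0 \<or> y = b"
  proof (cases "\<exists>b\<in>P - {x}. u \<bullet> (b - x) = 0")
    case True
    then obtain b where b: "b \<in> P - {x}" "u \<bullet> (b - x) = 0" by blast
    have "u \<bullet> (y - x) < 0 \<or> y = b" if "y \<in> ?S" for y
      using that b uniq[of y b] by (cases "u \<bullet> (y - x) = 0") auto
    with b that[of b] show ?thesis by simp
  next
    case False
    then have "u \<bullet> (y - x) < 0" if "y \<in> ?S" for y
      using that by (auto simp: less_le)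
    \<comment> \<open>With no point of \<open>P\<close> on the boundary, \<open>b\<close> is a dummy
      inside the open half-plane.\<close>
    moreover have "x - u \<noteq> x" "u \<bullet> (x - u - x) \<le> 0" using \<open>u \<noteq> 0\<close> by simp_all
    ultimately show ?thesis using that by blast
  qed
  let ?K = "insert b {y. u \<bullet> (y - x) < 0}"
  have "convex ?K"
  proof (rule convexI)
    fix p q and s t :: real
    assume pq: "p \<in> ?K" "q \<in> ?K" and st: "0 \<le> s" "0 \<le> t" "s + t = 1"
    have eq: "u \<bullet> (s *\<^sub>R p + t *\<^sub>R q - x) = s * (u \<bullet> (p - x)) + t * (u \<bullet> (q - x))"
    proof -
      have "s *\<^sub>R p + t *\<^sub>R q - x = s *\<^sub>R (p - x) + t *\<^sub>R (q - x)"
        unfolding eq_diff_eq[THEN iffD2, OF \<open>s + t = 1\<close>] by (simp add: algebra_simps)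
      then show ?thesis by (simp add: inner_add_right)
    qed
    have le: "u \<bullet> (p - x) \<le> 0" "u \<bullet> (q - x) \<le> 0" using pq b(2) by auto
    show "s *\<^sub>R p + t *\<^sub>R q \<in> ?K"
    proof (cases "p = q \<or> s = 0 \<or> t = 0")
      case True
      then consider "p = q" | "s = 0" | "t = 0" by blast
      then show ?thesis
      proof cases
        case 1
        then have "s *\<^sub>R p + t *\<^sub>R q = p" using st by (simp flip: scaleR_add_left)
        then show ?thesis using pq by simp
      qed (use pq st in simp_all)
    next
      case False
      \<comment> \<open>As \<open>p\<close> and \<open>q\<close> differ, at most one of them is
        \<open>b\<close>.\<close>
      then have "0 < s" "0 < t" and "u \<bullet> (p - x) < 0 \<or> u \<bullet> (q - x) < 0" using pq st by auto
      moreover have "s * (u \<bullet> (p - x)) \<le> 0" "t * (u \<bullet> (q - x)) \<le> 0"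
        using st le by (simp_all add: mult_nonneg_nonpos)
      ultimately have "s * (u \<bullet> (p - x)) + t * (u \<bullet> (q - x)) < 0"
        using mult_pos_neg by (metis add_neg_nonpos add_nonpos_neg)
      then show ?thesis using eq by simp
    qed
  qed
  moreover have "?S \<subseteq> ?K" using b(3) by blast
  ultimately have "convex hull ?S \<subseteq> ?K" by (intro hull_minimal)
  moreover have "x \<notin> ?K" using b(1) by auto
  ultimately show ?thesis by blast
qed

text \<open>A colouring \<open>R\<close> without monochromatic edge would give two open sets
  covering the circle, neither containing an antipodal pair. This makes them disjoint on the circle,
  so by connectedness one of them contains the whole circle, a contradiction.\<close>

lemma separating_family_not_bipartite:
  fixes beats :: "'l \<Rightarrow> real^2 \<Rightarrow> real^2 \<Rightarrow> bool"
  assumes "finite P" "general_position P" "x \<in> P"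
    and sep: "\<And>A. A \<subseteq> P - {x} \<Longrightarrow> x \<notin> convex hull A \<Longrightarrow> \<exists>l\<in>E. \<forall>y\<in>A. beats l x y"
  shows "\<exists>l\<in>E. \<exists>m\<in>E. (l \<in> R \<longleftrightarrow> m \<in> R) \<and> (\<forall>y\<in>P - {x}. beats l x y \<or> beats m x y)"
proof (rule ccontr)
  assume neg: "\<not> ?thesis"
  \<comment> \<open>Stated contrapositively: all points that \<open>x\<close> does not beat lie
    strictly ahead. This exhibits \<open>U l\<close> as a finite intersection of open
    half-planes.\<close>
  define U where "U l = (\<Inter>y\<in>{y\<in>P - {x}. \<not> beats l x y}. {u. u \<bullet> (y - x) > 0})" for l
  define V where "V S = (\<Union>l\<in>S. U l)" for S
  have "open {u. u \<bullet> (y - x) > 0}" for y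
    using open_halfspace_gt[of 0 "y - x"] by (simp add: inner_commute)
  then have "open (U l)" for l
    using \<open>finite P\<close> unfolding U_def by (intro open_INT) auto
  then have open_V: "open (V S)" for S unfolding V_def by auto
  have cover: "u \<in> V (E \<inter> R) \<or> u \<in> V (E - R)" if "u \<noteq> 0" for u
  proof -
    have "\<exists>l\<in>E. \<forall>y\<in>{y\<in>P - {x}. u \<bullet> (y - x) \<le> 0}. beats l x y"
      by (intro sep not_in_convex_hull_of_closed_halfplane assms that) auto
    then obtain l where "l \<in> E" "u \<in> U l" unfolding U_def by force
    then show ?thesis unfolding V_def by blast
  qed
  \<comment> \<open>A point beaten in neither order would lie strictly ahead in both directions
    \<open>u\<close> and \<open>- u\<close>.\<close>
  have antipodal: "\<forall>y\<in>P - {x}. beats l x y \<or> beats m x y" if "u \<in> U l" "- u \<in> U m" for l m u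
    using that unfolding U_def by force
  then have V_antipodal: "- u \<notin> V S" if "u \<in> V S" "S = E \<inter> R \<or> S = E - R" for u S
    using that neg unfolding V_def by blast
  have "connected (sphere (0::real^2) 1)" by (rule connected_sphere) simp
  moreover have "V (E \<inter> R) \<inter> V (E - R) \<inter> sphere 0 1 = {}"
  proof -
    have "u \<notin> V (E - R)" if "u \<in> V (E \<inter> R)" "norm u = 1" for u
      using that cover[of "- u"] V_antipodal[of u] by force
    then show ?thesis by auto
  qed
  moreover have "sphere 0 1 \<subseteq> V (E \<inter> R) \<union> V (E - R)"
  proof
    fix u :: "real^2" assume "u \<in> sphere 0 1"
    then have "u \<noteq> 0" by auto
    then show "u \<in> V (E \<inter> R) \<union> V (E - R)" using cover by blast
  qed
  ultimately have "V (E \<inter> R) \<inter> sphere 0 1 = {} \<or> V (E - R) \<inter> sphere 0 1 = {}"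
    using open_V by (intro connectedD)
  moreover have "u \<in> V S" if "V S' \<inter> sphere 0 1 = {}" "norm u = 1"
    "(S = E \<inter> R \<and> S' = E - R) \<or> (S = E - R \<and> S' = E \<inter> R)" for S S' u
    using that cover[of u] by force
  moreover obtain u :: "real^2" where "norm u = 1" using vector_choose_size[of 1] by auto
  ultimately show False
    using V_antipodal[of u] norm_minus_cancel[of u] by metis
qed

section \<open>Realizers of the lattice of closed sets\<close>

text \<open>Reading a set as a binary number is injective and monotone under inclusion.\<close>

lemma linear_extension_set_encode:
  assumes "finite P" "F \<subseteq> Pow P" "inj_on e P"
  shows "linear_extension_on F (inclusion_on F)
           {(S, T) \<in> F \<times> F. set_encode (e ` S) \<le> set_encode (e ` T)}"
proof -
  have fin: "finite S" if "S \<in> F" for S using that assms by (auto intro: finite_subset)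
  have inj: "S = T" if "S \<in> F" "T \<in> F" "set_encode (e ` S) = set_encode (e ` T)" for S T
  proof -
    have "e ` S = e ` T" using that fin by (simp add: set_encode_eq)
    moreover have "S \<subseteq> P" "T \<subseteq> P" using that assms by auto
    ultimately show ?thesis using assms(3) by (simp add: inj_on_image_eq_iff)
  qed
  have mono: "set_encode (e ` S) \<le> set_encode (e ` T)" if "S \<subseteq> T" "T \<in> F" for S T
    unfolding set_encode_def using that fin by (intro sum_mono2) auto
  show ?thesis
    unfolding linear_extension_on_def order_on_defs inclusion_on_def
    using inj mono by (auto simp: refl_on_def trans_def antisym_def total_on_def)
qed

text \<open>Giving a point \<open>a\<close> of \<open>A - B\<close> the top bit makes the code of
  \<open>A\<close> exceed that of \<open>B\<close>.\<close>

lemma linear_extension_reversing: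
  assumes "finite P" "F \<subseteq> Pow P" "A \<in> F" "B \<in> F" "\<not> A \<subseteq> B"
  shows "\<exists>l. linear_extension_on F (inclusion_on F) l \<and> (A, B) \<notin> l"
proof -
  obtain a where a: "a \<in> A" "a \<notin> B" using assms by blast
  obtain e0 :: "_ \<Rightarrow> nat" where e0: "inj_on e0 P"
    using finite_imp_inj_to_nat_seg \<open>finite P\<close> by metis
  define N where "N = Suc (Max (e0 ` P))"
  define e where "e = e0(a := N)"
  have lt: "e0 p < N" if "p \<in> P" for p
    using that \<open>finite P\<close> by (simp add: N_def le_imp_less_Suc)
  have e: "inj_on e P"
    using e0 lt by (force simp: inj_on_def e_def)
  have fin: "finite A" using assms(1-3) by (meson PowD finite_subset subsetD)
  have "e ` B \<subseteq> {..<N}" using a(2) lt assms by (auto simp: e_def)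
  then have "set_encode (e ` B) \<le> (\<Sum>i<N. 2 ^ i)"
    unfolding set_encode_def by (intro sum_mono2) auto
  also have "\<dots> < (2::nat) ^ N" by (induction N) auto
  also have "\<dots> = set_encode {e a}" by (simp add: e_def set_encode_def)
  also have "\<dots> \<le> set_encode (e ` A)"
    unfolding set_encode_def using a fin by (intro sum_mono2) auto
  finally show ?thesis
    by (intro exI[of _ "{(S, T) \<in> F \<times> F. set_encode (e ` S) \<le> set_encode (e ` T)}"])
      (use linear_extension_set_encode[OF assms(1,2) e] in auto)
qed

text \<open>The set of all linear extensions serves. This ensures that the \<open>LEAST\<close> in
  \<open>order_dimension_on\<close> is attained.\<close>

lemma realizer_exists:
  assumes "finite P" "F \<subseteq> Pow P"
  obtains E where "0 < card E" "\<forall>l\<in>E. linear_extension_on F (inclusion_on F) l"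
    "\<Inter>E = inclusion_on F"
proof -
  define E where "E = {l. linear_extension_on F (inclusion_on F) l}"
  have "finite F" using assms by (meson finite_Pow_iff finite_subset)
  have sub: "l \<subseteq> F \<times> F" if "l \<in> E" for l
    using that by (auto simp: E_def linear_extension_on_def order_on_defs)
  then have "finite E" using \<open>finite F\<close> by (intro finite_subset[of E "Pow (F \<times> F)"]) auto
  moreover have "E \<noteq> {}"
    using finite_imp_inj_to_nat_seg[OF assms(1)] linear_extension_set_encode[OF assms]
    unfolding E_def by blast
  moreover have "\<Inter>E = inclusion_on F"
  proof
    show "inclusion_on F \<subseteq> \<Inter>E" by (auto simp: E_def linear_extension_on_def)
    show "\<Inter>E \<subseteq> inclusion_on F"
    proof (rule subrelI)
      fix A B assume AB: "(A, B) \<in> \<Inter>E"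
      then have "A \<in> F" "B \<in> F" using \<open>E \<noteq> {}\<close> sub by blast+
      then show "(A, B) \<in> inclusion_on F"
        using linear_extension_reversing[OF assms, of A B] AB
        by (auto simp: E_def inclusion_on_def)
    qed
  qed
  moreover have "\<forall>l\<in>E. linear_extension_on F (inclusion_on F) l" by (simp add: E_def)
  ultimately show ?thesis by (metis that card_gt_0_iff)
qed

theorem corollary4p7:
  fixes P :: "(real^2) set" and k :: nat
  assumes "finite P"
    and "general_position P"
    and "0 < k"
    and "conv_dim P = k"
  shows "card P \<le> 2 ^ (k - 1)"
proof -
  let ?F = "closed_subsets P"
  have F: "?F \<subseteq> Pow P" by (auto simp: closed_subsets_def)
  let ?Q = "\<lambda>t. 0 < t \<and> (\<exists>E. card E = t \<and> (\<forall>l\<in>E. linear_extension_on ?F (inclusion_on ?F) l)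
                \<and> \<Inter>E = inclusion_on ?F)"
  have "\<exists>t. ?Q t" using realizer_exists[OF assms(1) F] by metis
  then have "?Q k" using LeastI_ex[of ?Q] assms(4)
    unfolding conv_dim_def order_dimension_on_def by simp
  then obtain E where E: "card E = k" and lin: "\<And>l. l \<in> E \<Longrightarrow> linear_extension_on ?F (inclusion_on ?F) l"
    and Inter: "\<Inter>E = inclusion_on ?F" by blast
  \<comment> \<open>Positive cardinality excludes both, since \<open>card\<close> is 0 on infinite
    sets.\<close>
  have "finite E" "E \<noteq> {}" using E \<open>0 < k\<close> by (auto intro: card_ge_0_finite)
  have singleton: "{x} \<in> ?F" if "x \<in> P" for x
    using that by (auto simp: closed_subsets_def conv_closure_def)
  have closure: "conv_closure P A \<in> ?F" for A
  proof -
    have "convex hull (convex hull A \<inter> P) \<subseteq> convex hull A"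
      by (intro hull_minimal) auto
    moreover have "convex hull A \<inter> P \<subseteq> convex hull (convex hull A \<inter> P)" by (rule hull_subset)
    ultimately show ?thesis by (auto simp: closed_subsets_def conv_closure_def)
  qed
  let ?beats = "\<lambda>l x y. ({y}, {x}) \<in> l"
  have "card P \<le> 2 ^ (card E - 1)"
  proof (rule card_le_if_not_bipartite[where beats = ?beats])
    fix l x y assume "l \<in> E" "x \<in> P" "y \<in> P" "x \<noteq> y" "({y}, {x}) \<in> l"
    then show "({x}, {y}) \<notin> l"
      using lin[of l] by (auto simp: linear_extension_on_def order_on_defs antisym_def)
  next
    fix x R assume x: "x \<in> P"
    show "\<exists>l\<in>E. \<exists>m\<in>E. (l \<in> R \<longleftrightarrow> m \<in> R) \<and> (\<forall>y\<in>P - {x}. ?beats l x y \<or> ?beats m x y)"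
    proof (rule separating_family_not_bipartite[OF assms(1,2) x])
      fix A assume A: "A \<subseteq> P - {x}" "x \<notin> convex hull A"
      let ?C = "conv_closure P A"
      \<comment> \<open>Some \<open>l\<close> thus fails to put \<open>{x}\<close> below the closure
        of \<open>A\<close>; by totality it puts the closure, and with it each \<open>{y}\<close>
        for \<open>y\<close> in \<open>A\<close>, below \<open>{x}\<close>.\<close>
      have "({x}, ?C) \<notin> \<Inter>E"
        using A unfolding Inter by (auto simp: inclusion_on_def conv_closure_def)
      then obtain l where l: "l \<in> E" "({x}, ?C) \<notin> l" by blast
      have "x \<notin> ?C" using A by (auto simp: conv_closure_def)
      then have "{x} \<noteq> ?C" by blast
      have tot: "total_on ?F l" "trans l" "inclusion_on ?F \<subseteq> l"
        using lin[OF l(1)] by (auto simp: linear_extension_on_def order_on_defs)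
      from tot(1) have Cx: "(?C, {x}) \<in> l"
        using singleton[OF x] closure[of A] l(2) \<open>{x} \<noteq> ?C\<close> unfolding total_on_def by metis
      have "({y}, {x}) \<in> l" if "y \<in> A" for y
      proof -
        have "y \<in> P" "y \<in> convex hull A" using that A by (auto intro: hull_inc)
        then have "({y}, ?C) \<in> inclusion_on ?F"
          using singleton closure by (auto simp: inclusion_on_def conv_closure_def)
        then have "({y}, ?C) \<in> l" using tot(3) by (rule subsetD[rotated])
        then show ?thesis using tot(2) Cx by (meson transD)
      qed
      then show "\<exists>l\<in>E. \<forall>y\<in>A. ?beats l x y" using l(1) by blast
    qed
  qed fact+
  then show ?thesis using E by simp
qed

end
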